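(* Let $\alpha\in(0,3]$, let $f\in\mathcal{F}(\alpha)$, and let $\phi\in\mathbb{B}$ satisfy $$\frac{f''(z)}{f'(z)}=\frac{\alpha\,\phi(z)}{1-z\phi(z)}\quad\text{for all } z\in\mathbb{D}.$$ Let $m\geq1$ be an integer. Then $\phi$ is a finite Blaschke product of degree $m$ if and only if $$f'(z)=\prod_{k=1}^{m+1}\frac{1}{(1-\zeta_kz)^{\alpha t_k}}\quad (z\in\mathbb{D}),$$ for some distinct points $\zeta_1,\dots,\zeta_{m+1}\in\mathbb{T}$ and real numbers $t_1,\dots,t_{m+1}$ with $0<t_k<1$ and $\sum_{k=1}^{m+1}t_k=1$.
   Context: $\mathbb{D}=\{z\in\mathbb{C}:|z|<1\}$ and $\mathbb{T}=\{z\in\mathbb{C}:|z|=1\}$. $\mathcal{A}$ is the family of analytic functions $h$ in $\mathbb{D}$ with $h(0)=0$ and $h'(0)=1$. For $\alpha\in(0,3]$, $\mathcal{F}(\alpha)$ is the family of locally univalent functions $h\in\mathcal{A}$ (i.e. $h'(z)\neq0$ in $\mathbb{D}$) such that $\operatorname{Re}\left(1+\frac{zh''(z)}{h'(z)}\right)>1-\frac{\alpha}{2}$ for all $z\in\mathbb{D}$. $\mathbb{B}$ is the set of all analytic functions $\omega$ in $\mathbb{D}$ with $|\omega(z)|\le1$ for all $z\in\mathbb{D}$. A finite Blaschke product of degree $m$ is a function $e^{i\theta}\prod_{k=1}^m\frac{z-b_k}{1-\overline{b_k}z}$ with $\theta\in\mathbb{R}$, $b_k\in\mathbb{D}$. Powers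 $(1-\zeta_kz)^{\alpha t_k}$ are taken with the branch equal to $1$ at $z=0$. *)

theory Defs
  imports "HOL-Analysis.Analysis"
begin

abbreviation unit_disc :: "complex set" ("\<D>")
  where "\<D> \<equiv> ball 0 1"

abbreviation unit_circle :: "complex set" ("\<T>")
  where "\<T> \<equiv> sphere 0 1"

text \<open>
  Analytic functions in the disc are total functions on the complex plane that are holomorphic on
  the open unit disc; their values outside the disc are irrelevant. Accordingly all identities
  between such functions are stated pointwise on the disc.
\<close>

definition class_A :: "(complex \<Rightarrow> complex) set" where
  "class_A = {h. h holomorphic_on \<D> \<and> h 0 = 0 \<and> deriv h 0 = 1}"

definition class_F :: "real \<Rightarrow> (complex \<Rightarrow> complex) set" where
  "class_F \<alpha> = {h \<in> class_A.
     (\<forall>z\<in>\<D>. deriv h z \<noteq> 0) \<and>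
     (\<forall>z\<in>\<D>. Re (1 + z * deriv (deriv h) z / deriv h z) > 1 - \<alpha> / 2)}"

definition class_B :: "(complex \<Rightarrow> complex) set" where
  "class_B = {\<omega>. \<omega> holomorphic_on \<D> \<and> (\<forall>z\<in>\<D>. norm (\<omega> z) \<le> 1)}"

definition finite_Blaschke_product :: "nat \<Rightarrow> (complex \<Rightarrow> complex) \<Rightarrow> bool" where
  "finite_Blaschke_product m \<phi> \<longleftrightarrow>
     (\<exists>(\<theta>::real) (b :: nat \<Rightarrow> complex).
        (\<forall>k\<in>{1..m}. b k \<in> \<D>) \<and>
        (\<forall>z\<in>\<D>. \<phi> z = exp (\<i> * of_real \<theta>) * (\<Prod>k=1..m. (z - b k) / (1 - cnj (b k) * z))))"

text \<open>
  For \<open>\<zeta> \<in> \<T>\<close> and \<open>z \<in> \<D>\<close> the number \<open>1 - \<zeta> * z\<close> has positive real part, so the principal power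
  \<open>(1 - \<zeta> * z) powr a\<close> is holomorphic in \<open>z\<close> on the disc and equals 1 at \<open>z = 0\<close>; it is the
  branch of the power normalised by the value 1 at the origin.
\<close>

end

theory Submission
  imports Defs
    "HOL-Complex_Analysis.Cauchy_Integral_Formula"
    "HOL-Computational_Algebra.Fundamental_Theorem_Algebra"
begin

text \<open>
  Taking logarithmic derivatives turns the product formula for \<open>f'\<close> into the partial fraction
  expansion \<open>\<phi>(z) / (1 - z \<phi>(z)) = (\<Sum>k. t\<^sub>k \<zeta>\<^sub>k / (1 - \<zeta>\<^sub>k z))\<close>; nothing is lost, because \<open>f'(0) = 1\<close>
  fixes the constant of integration (\<open>eq_prod_powr_iff_log_deriv\<close>). What remains is algebra. Put
  \<open>R = (\<Prod>k. 1 - \<zeta>\<^sub>k z)\<close> and \<open>L\<^sub>k = R / (1 - \<zeta>\<^sub>k z)\<close>, and set \<open>Q = (\<Sum>k. t\<^sub>k L\<^sub>k)\<close> and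
  \<open>N = (\<Sum>k. t\<^sub>k \<zeta>\<^sub>k L\<^sub>k)\<close>. Since the weights add up to 1, \<open>Q - z N = R\<close>, and the expansion says
  exactly \<open>\<phi> Q = N\<close>.

  If \<open>\<phi> = A / B\<close> is a Blaschke product of degree \<open>m\<close>, the \<open>1 / \<zeta>\<^sub>k\<close> have to be the \<open>m + 1\<close> solutions
  of \<open>z \<phi>(z) = 1\<close>, that is, the roots of \<open>B - z A\<close>. They lie on the circle because \<open>|z \<phi>(z)|\<close> is
  less than 1 inside and greater than 1 outside the disc, and they are simple because the argument
  of \<open>z \<phi>(z)\<close> strictly increases along the circle: its speed at \<open>w\<close> is
  \<open>s = 1 + (\<Sum>k. (1 - |b\<^sub>k|\<^sup>2) / |w - b\<^sub>k|\<^sup>2)\<close>. The residues turn out to be the numbers \<open>1 / s\<close>, which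
  explains \<open>0 < t\<^sub>k < 1\<close> (\<open>Blaschke_fraction_partial_fractions\<close>).

  Conversely, reflection in the circle maps \<open>Q\<close> to \<open>N\<close> up to a unimodular constant, because the
  \<open>\<zeta>\<^sub>k\<close> are unimodular and the \<open>t\<^sub>k\<close> are real. So as soon as \<open>Q\<close> has no zeros in the closed disc,
  factoring \<open>Q\<close> displays \<open>N / Q\<close> as a Blaschke product (\<open>partial_fractions_Blaschke_fraction\<close>). A
  zero of \<open>Q\<close> in the open disc would by \<open>\<phi> Q = N\<close> be a zero of \<open>R\<close>, and one on the circle likewise
  by reflection; but \<open>R\<close> vanishes only at the \<open>1 / \<zeta>\<^sub>k\<close>, where \<open>Q\<close> does not.
\<close>

section \<open>Polynomials normalised at the origin\<close>

text \<open>
  Roots are recorded by their reciprocals, so that \<open>c k = 0\<close> stands for a root at infinity and any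
  upper bound \<open>n\<close> for the degree can serve as the number of factors.
\<close>

lemma poly_factorization_reciprocal_roots:
  fixes q :: "complex poly"
  assumes "poly q 0 = 1" and "degree q \<le> n"
  shows "\<exists>c. q = (\<Prod>k\<in>{1..n}. [:1, - c k:])"
  using assms
proof (induction n arbitrary: q)
  case 0
  then obtain a where "q = [:a:]"
    by (metis degree_eq_zeroE le_zero_eq)
  with 0 show ?case by (auto simp: one_pCons)
next
  case (Suc n)
  show ?case
  proof (cases "degree q = 0")
    case True
    then obtain a where "q = [:a:]"
      by (metis degree_eq_zeroE)
    with Suc.prems have "q = (\<Prod>k\<in>{1..Suc n}. [:1, - (0::complex):])"
      by (simp add: one_pCons[symmetric])
    then show ?thesis by (intro exI[of _ "\<lambda>_. 0"]) simp
  next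
    case False
    then obtain a where a: "poly q a = 0"
      using fundamental_theorem_of_algebra[of q] constant_degree[of q] by auto
    with Suc.prems have a0: "a \<noteq> 0" by auto
    from a obtain r where r: "q = [:-a, 1:] * r"
      by (auto simp: poly_eq_0_iff_dvd dvd_def)
    define r' where "r' = smult (- a) r"
    have "[:1, - (1/a):] = smult (- (1/a)) [:-a, 1:]"
      using a0 by simp
    then have q: "q = [:1, - (1/a):] * r'"
      using a0 unfolding r r'_def
      by (simp only: mult_smult_left mult_smult_right smult_smult) simp
    have "r' \<noteq> 0" using q Suc.prems by auto
    then have "degree q = Suc (degree r')"
      using a0 unfolding q by (subst degree_mult_eq) auto
    then obtain c where c: "r' = (\<Prod>k\<in>{1..n}. [:1, - c k:])"
      using Suc.IH[of r'] Suc.prems q by auto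
    have "q = (\<Prod>k\<in>{1..Suc n}. [:1, - (c(Suc n := 1/a)) k:])"
    proof -
      have "(\<Prod>k\<in>{1..Suc n}. [:1, - (c(Suc n := 1/a)) k:])
          = (\<Prod>k\<in>{1..n}. [:1, - (c(Suc n := 1/a)) k:]) * [:1, - (1/a):]"
        by (subst prod.cl_ivl_Suc) auto
      also have "(\<Prod>k\<in>{1..n}. [:1, - (c(Suc n := 1/a)) k:]) = r'"
        unfolding c by (intro prod.cong) auto
      finally show ?thesis using q by (simp add: mult.commute)
    qed
    then show ?thesis by blast
  qed
qed

lemma poly_pderiv_prod_log_deriv:
  fixes p :: "'i \<Rightarrow> complex poly"
  assumes "finite I" and "\<And>k. k \<in> I \<Longrightarrow> poly (p k) x \<noteq> 0"
  shows "poly (pderiv (\<Prod>k\<in>I. p k)) x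
    = poly (\<Prod>k\<in>I. p k) x * (\<Sum>k\<in>I. poly (pderiv (p k)) x / poly (p k) x)"
  using assms
proof (induction I rule: finite_induct)
  case empty
  then show ?case by simp
next
  case (insert i I)
  then show ?case by (simp add: pderiv_mult field_simps)
qed

lemma poly_eqI_nonzero:
  fixes p q :: "complex poly"
  assumes "\<And>z. z \<noteq> 0 \<Longrightarrow> poly p z = poly q z"
  shows "p = q"
proof -
  have "poly ([:0, 1:] * p) z = poly ([:0, 1:] * q) z" for z
    using assms[of z] by (cases "z = 0") auto
  then have "[:0, 1:] * p = [:0, 1:] * q"
    by (simp add: poly_eq_poly_eq_iff[symmetric] fun_eq_iff)
  then show ?thesis by (subst (asm) mult_left_cancel) auto
qed

section \<open>Partial fractions with poles on the circle\<close>

text \<open>The polynomial \<open>L\<^sub>k = R / (1 - \<zeta>\<^sub>k z)\<close>.\<close>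

definition cofactor :: "('i \<Rightarrow> complex) \<Rightarrow> 'i set \<Rightarrow> 'i \<Rightarrow> complex poly" where
  "cofactor \<zeta> I k = (\<Prod>j\<in>I - {k}. [:1, - \<zeta> j:])"

text \<open>
  The numerators of \<open>\<Sum>k\<in>I. t k / (1 - \<zeta> k * z)\<close> and of \<open>\<Sum>k\<in>I. t k * \<zeta> k / (1 - \<zeta> k * z)\<close> over the
  common denominator; in the quotient \<open>\<phi> = N / Q\<close> they are denominator and numerator.
\<close>

definition pf_denom :: "('i \<Rightarrow> complex) \<Rightarrow> ('i \<Rightarrow> real) \<Rightarrow> 'i set \<Rightarrow> complex poly" where
  "pf_denom \<zeta> t I = (\<Sum>k\<in>I. smult (of_real (t k)) (cofactor \<zeta> I k))"

definition pf_numer :: "('i \<Rightarrow> complex) \<Rightarrow> ('i \<Rightarrow> real) \<Rightarrow> 'i set \<Rightarrow> complex poly" where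
  "pf_numer \<zeta> t I = (\<Sum>k\<in>I. smult (of_real (t k) * \<zeta> k) (cofactor \<zeta> I k))"

lemma prod_eq_factor_times_cofactor:
  assumes "finite I" and "k \<in> I"
  shows "(\<Prod>j\<in>I. [:1, - \<zeta> j:]) = [:1, - \<zeta> k:] * cofactor \<zeta> I k"
  unfolding cofactor_def using assms by (rule prod.remove)

lemma degree_cofactor_le:
  assumes "finite I" and "k \<in> I"
  shows "degree (cofactor \<zeta> I k) \<le> card I - 1"
proof -
  have "degree (cofactor \<zeta> I k) \<le> (\<Sum>j\<in>I - {k}. degree [:1, - \<zeta> j:])"
    unfolding cofactor_def
    using degree_prod_sum_le[of "I - {k}" "\<lambda>j. [:1, - \<zeta> j:]"] assms by (simp add: o_def)
  also have "\<dots> \<le> (\<Sum>j\<in>I - {k}. 1)"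
    by (intro sum_mono) auto
  also have "\<dots> = card I - 1" using assms by simp
  finally show ?thesis .
qed

lemma poly_cofactor_0 [simp]: "poly (cofactor \<zeta> I k) 0 = 1"
  by (simp add: cofactor_def poly_prod)

lemma poly_cofactor_reciprocal_eq_0:
  assumes "finite I" and "j \<in> I" and "j \<noteq> k" and "\<zeta> j \<noteq> 0"
  shows "poly (cofactor \<zeta> I k) (1 / \<zeta> j) = 0"
  unfolding cofactor_def poly_prod using assms by (intro prod_zero) (auto intro!: bexI[of _ j])

lemma poly_cofactor_reciprocal_neq_0:
  assumes "finite I" and "k \<in> I" and "inj_on \<zeta> I" and "\<zeta> k \<noteq> 0"
  shows "poly (cofactor \<zeta> I k) (1 / \<zeta> k) \<noteq> 0"
  unfolding cofactor_def poly_prod using assms by (auto simp: field_simps inj_on_def)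

lemma poly_pf_denom_reciprocal:
  assumes "finite I" and "k \<in> I" and "\<zeta> k \<noteq> 0"
  shows "poly (pf_denom \<zeta> t I) (1 / \<zeta> k) = of_real (t k) * poly (cofactor \<zeta> I k) (1 / \<zeta> k)"
proof -
  have "poly (pf_denom \<zeta> t I) (1 / \<zeta> k)
      = (\<Sum>j\<in>I. if j = k then of_real (t k) * poly (cofactor \<zeta> I k) (1 / \<zeta> k) else 0)"
    unfolding pf_denom_def poly_sum using assms
    by (intro sum.cong) (auto simp: poly_cofactor_reciprocal_eq_0)
  then show ?thesis using assms by simp
qed

lemma degree_pf_denom_le: "finite I \<Longrightarrow> degree (pf_denom \<zeta> t I) \<le> card I - 1"
  unfolding pf_denom_def using degree_cofactor_le[of I _ \<zeta>]
  by (intro degree_sum_le) (auto intro: order_trans[OF degree_smult_le])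

lemma poly_pf_denom_0: "poly (pf_denom \<zeta> t I) 0 = of_real (\<Sum>k\<in>I. t k)"
  by (simp add: pf_denom_def poly_sum)

text \<open>Summand by summand, \<open>L\<^sub>k - \<zeta>\<^sub>k z L\<^sub>k = R\<close>; the weights \<open>t\<^sub>k\<close> average this to \<open>Q - z N = R\<close>.\<close>

lemma pf_denom_minus_numer:
  assumes "finite I" and "(\<Sum>k\<in>I. t k) = 1"
  shows "pf_denom \<zeta> t I - [:0, 1:] * pf_numer \<zeta> t I = (\<Prod>k\<in>I. [:1, - \<zeta> k:])"
proof -
  have "pf_denom \<zeta> t I - [:0, 1:] * pf_numer \<zeta> t I
      = (\<Sum>k\<in>I. smult (of_real (t k)) (\<Prod>j\<in>I. [:1, - \<zeta> j:]))"
    unfolding pf_denom_def pf_numer_def sum_distrib_left sum_subtractf[symmetric]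
  proof (rule sum.cong)
    fix k assume "k \<in> I"
    show "smult (of_real (t k)) (cofactor \<zeta> I k)
        - [:0, 1:] * smult (of_real (t k) * \<zeta> k) (cofactor \<zeta> I k)
        = smult (of_real (t k)) (\<Prod>j\<in>I. [:1, - \<zeta> j:])"
      unfolding prod_eq_factor_times_cofactor[OF assms(1) \<open>k \<in> I\<close>, of \<zeta>]
      by (rule poly_ext) (simp add: algebra_simps)
  qed simp
  also have "\<dots> = smult (of_real (\<Sum>k\<in>I. t k)) (\<Prod>j\<in>I. [:1, - \<zeta> j:])"
    by (simp add: smult_sum)
  finally show ?thesis using assms by simp
qed

lemma pf_common_zero:
  assumes "finite I" and "(\<Sum>k\<in>I. t k) = 1"
    and "poly (pf_denom \<zeta> t I) z = 0" and "poly (pf_numer \<zeta> t I) z = 0"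
  shows "\<exists>k\<in>I. 1 - \<zeta> k * z = 0"
proof -
  have "poly (\<Prod>k\<in>I. [:1, - \<zeta> k:]) z = 0"
    unfolding pf_denom_minus_numer[OF assms(1,2), symmetric] using assms(3,4) by simp
  with \<open>finite I\<close> show ?thesis by (auto simp: poly_prod mult.commute)
qed

text \<open>
  With \<open>u = \<phi>(z)\<close>, the expansion over the common denominator is \<open>u / (1 - z u) = N / R\<close>, that is,
  \<open>u (R + z N) = N\<close>; and \<open>R + z N = Q\<close>.
\<close>

lemma partial_fractions_iff_quotient:
  fixes \<zeta> :: "'i \<Rightarrow> complex" and t :: "'i \<Rightarrow> real"
  assumes "finite I" and "(\<Sum>k\<in>I. t k) = 1"
    and "\<And>k. k \<in> I \<Longrightarrow> 1 - \<zeta> k * z \<noteq> 0" and "1 - z * u \<noteq> 0"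
  shows "u / (1 - z * u) = (\<Sum>k\<in>I. of_real (t k) * \<zeta> k / (1 - \<zeta> k * z))
    \<longleftrightarrow> u * poly (pf_denom \<zeta> t I) z = poly (pf_numer \<zeta> t I) z"
proof -
  define R where "R = poly (\<Prod>k\<in>I. [:1, - \<zeta> k:]) z"
  have R0: "R \<noteq> 0"
    unfolding R_def poly_prod using assms by (auto simp: mult.commute)
  have N: "(\<Sum>k\<in>I. of_real (t k) * \<zeta> k / (1 - \<zeta> k * z)) = poly (pf_numer \<zeta> t I) z / R"
    unfolding pf_numer_def poly_sum sum_divide_distrib
  proof (rule sum.cong)
    fix k assume k: "k \<in> I"
    then have "R = (1 - \<zeta> k * z) * poly (cofactor \<zeta> I k) z"
      unfolding R_def using prod_eq_factor_times_cofactor[OF assms(1) k, of \<zeta>]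
      by (simp add: algebra_simps)
    with R0 show "of_real (t k) * \<zeta> k / (1 - \<zeta> k * z)
        = poly (smult (of_real (t k) * \<zeta> k) (cofactor \<zeta> I k)) z / R"
      by simp
  qed simp
  have Q: "poly (pf_denom \<zeta> t I) z = R + z * poly (pf_numer \<zeta> t I) z"
    using arg_cong[OF pf_denom_minus_numer[OF assms(1,2), of \<zeta>], of "\<lambda>p. poly p z"]
    unfolding R_def by (simp add: algebra_simps)
  show ?thesis
    unfolding N Q using R0 assms(4) by (simp add: frac_eq_eq algebra_simps)
qed

section \<open>From Blaschke products to partial fractions\<close>

lemma norm_one_minus_cnj_mult_sq:
  fixes b z :: complex
  shows "(norm (1 - cnj b * z))\<^sup>2 - (norm (z - b))\<^sup>2 = (1 - (norm b)\<^sup>2) * (1 - (norm z)\<^sup>2)"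
  unfolding cmod_power2 by (simp add: power2_eq_square algebra_simps)

lemma norm_diff_le_norm_one_minus_cnj_mult:
  fixes b z :: complex
  assumes "norm b < 1" and "norm z \<le> 1"
  shows "norm (z - b) \<le> norm (1 - cnj b * z)"
proof -
  have "0 \<le> (1 - (norm b)\<^sup>2) * (1 - (norm z)\<^sup>2)"
    using assms by (intro mult_nonneg_nonneg) (auto simp: power_le_one)
  with norm_one_minus_cnj_mult_sq[of b z] have "(norm (z - b))\<^sup>2 \<le> (norm (1 - cnj b * z))\<^sup>2"
    by linarith
  then show ?thesis by (rule power2_le_imp_le) (rule norm_ge_zero)
qed

lemma norm_one_minus_cnj_mult_le_norm_diff:
  fixes b z :: complex
  assumes "norm b < 1" and "norm z \<ge> 1"
  shows "norm (1 - cnj b * z) \<le> norm (z - b)"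
proof -
  have "(1 - (norm b)\<^sup>2) * (1 - (norm z)\<^sup>2) \<le> 0"
    using assms by (intro mult_nonneg_nonpos) (auto simp: power_le_one one_le_power)
  with norm_one_minus_cnj_mult_sq[of b z] have "(norm (1 - cnj b * z))\<^sup>2 \<le> (norm (z - b))\<^sup>2"
    by linarith
  then show ?thesis by (rule power2_le_imp_le) (rule norm_ge_zero)
qed

lemma one_minus_cnj_mult_neq_0:
  fixes b z :: complex
  assumes "norm b < 1" and "norm z \<le> 1"
  shows "1 - cnj b * z \<noteq> 0"
proof
  assume "1 - cnj b * z = 0"
  then have "cnj b * z = 1" by simp
  then have "norm (cnj b * z) = 1" by simp
  moreover have "norm b * norm z < 1"
    using assms mult_left_le[of "norm z" "norm b"] by (auto intro: le_less_trans)
  ultimately show False by (simp add: norm_mult)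
qed

text \<open>
  On the circle \<open>1 - cnj b * w = w * cnj (w - b)\<close>, so that the logarithmic derivative of a Blaschke
  factor, multiplied by \<open>w\<close>, is real there.
\<close>

lemma Blaschke_factor_speed:
  fixes b w :: complex
  assumes "norm b < 1" and "norm w = 1"
  shows "w / (w - b) + cnj b * w / (1 - cnj b * w) = of_real ((1 - (norm b)\<^sup>2) / (norm (w - b))\<^sup>2)"
proof -
  have w: "w * cnj w = 1" using assms by (simp add: complex_norm_square[symmetric])
  have "w \<noteq> b" using assms by auto
  then have nz: "w - b \<noteq> 0" "cnj (w - b) \<noteq> 0" "w \<noteq> 0"
    using assms by (auto simp del: complex_cnj_diff)
  have "1 - cnj b * w = w * cnj (w - b)" using w by (simp add: algebra_simps)
  then have "cnj b * w / (1 - cnj b * w) = cnj b / cnj (w - b)"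
    using nz by simp
  then have "w / (w - b) + cnj b * w / (1 - cnj b * w)
      = (w * cnj (w - b) + cnj b * (w - b)) / ((w - b) * cnj (w - b))"
    using nz by (simp add: add_frac_eq mult.commute)
  also have "w * cnj (w - b) + cnj b * (w - b) = of_real (1 - (norm b)\<^sup>2)"
    using w complex_norm_square[of b] by (simp add: algebra_simps)
  also have "(w - b) * cnj (w - b) = of_real ((norm (w - b))\<^sup>2)"
    by (rule complex_norm_square[symmetric])
  finally show ?thesis by simp
qed

locale Blaschke_data =
  fixes m :: nat and c :: complex and b :: "nat \<Rightarrow> complex"
  assumes norm_c: "norm c = 1" and norm_b: "k \<in> {1..m} \<Longrightarrow> norm (b k) < 1"
begin

definition numer :: "complex poly" where
  "numer = smult c (\<Prod>k\<in>{1..m}. [:- b k, 1:])"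

definition denom :: "complex poly" where
  "denom = (\<Prod>k\<in>{1..m}. [:1, - cnj (b k):])"

lemma poly_numer: "poly numer z = c * (\<Prod>k\<in>{1..m}. z - b k)"
  by (simp add: numer_def poly_prod)

lemma poly_denom: "poly denom z = (\<Prod>k\<in>{1..m}. 1 - cnj (b k) * z)"
  by (simp add: denom_def poly_prod mult.commute)

lemma poly_denom_neq_0: "norm z \<le> 1 \<Longrightarrow> poly denom z \<noteq> 0"
  unfolding poly_denom using one_minus_cnj_mult_neq_0[OF norm_b] by auto

lemma poly_numer_neq_0: "norm z \<ge> 1 \<Longrightarrow> poly numer z \<noteq> 0"
  unfolding poly_numer using norm_b norm_c by fastforce

lemma norm_numer_le: "norm z \<le> 1 \<Longrightarrow> norm (poly numer z) \<le> norm (poly denom z)"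
  unfolding poly_numer poly_denom norm_mult prod_norm[symmetric] norm_c mult_1
  using norm_b by (intro prod_mono) (auto intro: norm_diff_le_norm_one_minus_cnj_mult)

lemma norm_denom_le: "norm z \<ge> 1 \<Longrightarrow> norm (poly denom z) \<le> norm (poly numer z)"
  unfolding poly_numer poly_denom norm_mult prod_norm[symmetric] norm_c mult_1
  using norm_b by (intro prod_mono) (auto intro: norm_one_minus_cnj_mult_le_norm_diff)

lemma norm_root_eq_1:
  assumes "poly (denom - [:0, 1:] * numer) w = 0"
  shows "norm w = 1"
proof -
  have eq: "norm (poly denom w) = norm w * norm (poly numer w)"
    using assms by (simp add: norm_mult[symmetric])
  have "\<not> norm w < 1"
  proof
    assume w: "norm w < 1"
    then have pos: "0 < norm (poly denom w)" using poly_denom_neq_0[of w] by simp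
    have "norm w * norm (poly numer w) \<le> norm w * norm (poly denom w)"
      using norm_numer_le[of w] w by (intro mult_left_mono) auto
    also have "\<dots> < 1 * norm (poly denom w)"
      using w pos by (intro mult_strict_right_mono) auto
    finally show False using eq by simp
  qed
  moreover have "\<not> norm w > 1"
  proof
    assume w: "norm w > 1"
    then have pos: "0 < norm (poly numer w)" using poly_numer_neq_0[of w] by simp
    have "1 * norm (poly numer w) < norm w * norm (poly numer w)"
      using w pos by (intro mult_strict_right_mono) auto
    with norm_denom_le[of w] w eq show False by simp
  qed
  ultimately show ?thesis by simp
qed

text \<open>
  Because \<open>w A(w) = B(w)\<close> at a root \<open>w\<close>, the derivative of \<open>B - z A\<close> there is \<open>- B\<close> times the
  logarithmic derivative of \<open>z A / B\<close>. Multiplied by \<open>w\<close>, the latter is the speed \<open>s\<close> of the argument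
  of \<open>z A / B\<close> along the circle: the factor \<open>z\<close> contributes 1 and every Blaschke factor a positive
  number, so that \<open>s > 1\<close> as soon as there is one.
\<close>

lemma root_pderiv:
  assumes root: "poly (denom - [:0, 1:] * numer) w = 0" and "m \<ge> 1"
  shows "\<exists>s::real. s > 1 \<and> - w * poly (pderiv (denom - [:0, 1:] * numer)) w = poly denom w * of_real s"
proof -
  have w: "norm w = 1" using norm_root_eq_1[OF root] .
  have wb: "w - b k \<noteq> 0" if "k \<in> {1..m}" for k using norm_b[OF that] w by auto
  have wb': "1 - cnj (b k) * w \<noteq> 0" if "k \<in> {1..m}" for k
    using one_minus_cnj_mult_neq_0[OF norm_b[OF that]] w by auto
  define s where "s = 1 + (\<Sum>k\<in>{1..m}. (1 - (norm (b k))\<^sup>2) / (norm (w - b k))\<^sup>2)"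
  have "0 < (\<Sum>k\<in>{1..m}. (1 - (norm (b k))\<^sup>2) / (norm (w - b k))\<^sup>2)"
  proof (rule sum_pos)
    fix k assume k: "k \<in> {1..m}"
    have "(norm (b k))\<^sup>2 < 1" using norm_b[OF k] by (simp add: power_less_one_iff)
    with wb[OF k] show "0 < (1 - (norm (b k))\<^sup>2) / (norm (w - b k))\<^sup>2" by simp
  qed (use \<open>m \<ge> 1\<close> in auto)
  then have "s > 1" by (simp add: s_def)
  have A': "poly (pderiv numer) w = poly numer w * (\<Sum>k\<in>{1..m}. 1 / (w - b k))"
    using poly_pderiv_prod_log_deriv[of "{1..m}" "\<lambda>k. [:- b k, 1:]" w] wb
    by (simp add: numer_def pderiv_smult pderiv_pCons)
  have B': "poly (pderiv denom) w = poly denom w * (\<Sum>k\<in>{1..m}. - cnj (b k) / (1 - cnj (b k) * w))"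
    using poly_pderiv_prod_log_deriv[of "{1..m}" "\<lambda>k. [:1, - cnj (b k):]" w] wb'
    by (simp add: denom_def pderiv_pCons mult.commute)
  have BA: "poly denom w = w * poly numer w" using root by simp
  have "- w * poly (pderiv (denom - [:0, 1:] * numer)) w
      = w * poly numer w + w * (w * poly (pderiv numer) w) - w * poly (pderiv denom) w"
    by (simp add: pderiv_diff pderiv_mult pderiv_pCons algebra_simps)
  also have "\<dots> = poly denom w + poly denom w * (w * (\<Sum>k\<in>{1..m}. 1 / (w - b k)))
      - w * (poly denom w * (\<Sum>k\<in>{1..m}. - cnj (b k) / (1 - cnj (b k) * w)))"
    unfolding A' B' BA by (simp add: algebra_simps)
  also have "\<dots> = poly denom w
      * (1 + (\<Sum>k\<in>{1..m}. w / (w - b k) + cnj (b k) * w / (1 - cnj (b k) * w)))"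
    by (simp add: sum.distrib sum_distrib_left sum_negf algebra_simps)
  also have "(\<Sum>k\<in>{1..m}. w / (w - b k) + cnj (b k) * w / (1 - cnj (b k) * w))
      = (\<Sum>k\<in>{1..m}. of_real ((1 - (norm (b k))\<^sup>2) / (norm (w - b k))\<^sup>2))"
    using norm_b w by (intro sum.cong refl Blaschke_factor_speed) auto
  also have "1 + \<dots> = of_real s" by (simp add: s_def)
  finally show ?thesis using \<open>s > 1\<close> by blast
qed

lemma degree_denom_le: "degree denom \<le> m"
proof -
  have "degree denom \<le> (\<Sum>k\<in>{1..m}. degree [:1, - cnj (b k):])"
    unfolding denom_def
    using degree_prod_sum_le[of "{1..m}" "\<lambda>k. [:1, - cnj (b k):]"] by (simp add: o_def)
  also have "\<dots> \<le> (\<Sum>k\<in>{1..m}. 1)" by (intro sum_mono) auto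
  finally show ?thesis by simp
qed

lemma degree_root_poly: "degree (denom - [:0, 1:] * numer) = m + 1"
proof -
  have c0: "c \<noteq> 0" using norm_c by auto
  then have "degree numer = m"
    unfolding numer_def by (simp add: degree_prod_sum_eq)
  moreover have "numer \<noteq> 0" using c0 unfolding numer_def by auto
  ultimately have "degree ([:0, 1:] * numer) = m + 1"
    by (subst degree_mult_eq) auto
  with degree_denom_le have "degree (- ([:0, 1:] * numer) + denom) = m + 1"
    by (subst degree_add_eq_left) auto
  then show ?thesis by (simp only: diff_conv_add_uminus add.commute)
qed

text \<open>
  The derivative of \<open>B - z A\<close> at its root \<open>1 / \<zeta>\<^sub>k\<close> gives \<open>L\<^sub>k = s\<^sub>k B\<close> there, which is nonzero; so the
  \<open>\<zeta>\<^sub>k\<close> are distinct. With \<open>t\<^sub>k = 1 / s\<^sub>k\<close> the polynomials \<open>Q\<close> and \<open>B\<close>, of degree at most \<open>m\<close>, agree at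
  these \<open>m + 1\<close> points.
\<close>

lemma Blaschke_fraction_partial_fractions:
  assumes "m \<ge> 1"
  obtains \<zeta> :: "nat \<Rightarrow> complex" and t :: "nat \<Rightarrow> real"
  where "\<And>k. k \<in> {1..m+1} \<Longrightarrow> norm (\<zeta> k) = 1" and "inj_on \<zeta> {1..m+1}"
    and "\<And>k. k \<in> {1..m+1} \<Longrightarrow> 0 < t k \<and> t k < 1" and "(\<Sum>k\<in>{1..m+1}. t k) = 1"
    and "pf_denom \<zeta> t {1..m+1} = denom" and "pf_numer \<zeta> t {1..m+1} = numer"
proof -
  let ?I = "{1..m+1}"
  define R where "R = denom - [:0, 1:] * numer"
  have denom_0: "poly denom 0 = 1" by (simp add: poly_denom)
  then have "poly R 0 = 1" by (simp add: R_def)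
  moreover have deg_R: "degree R = m + 1" unfolding R_def by (rule degree_root_poly)
  ultimately obtain \<zeta> where \<zeta>: "R = (\<Prod>k\<in>?I. [:1, - \<zeta> k:])"
    using poly_factorization_reciprocal_roots[of R "m + 1"] by auto
  \<comment> \<open>No root lies at infinity, because \<open>R\<close> has the full degree \<open>m + 1\<close>.\<close>
  have \<zeta>0: "\<zeta> k \<noteq> 0" if k: "k \<in> ?I" for k
  proof
    assume "\<zeta> k = 0"
    then have "R = cofactor \<zeta> ?I k"
      using prod_eq_factor_times_cofactor[OF _ k, of \<zeta>] by (simp add: \<zeta> one_pCons[symmetric])
    then have "degree R \<le> m" using degree_cofactor_le[OF _ k, of \<zeta>] by simp
    then show False using deg_R by simp
  qed
  have R_eq: "R = [:1, - \<zeta> k:] * cofactor \<zeta> ?I k" if "k \<in> ?I" for k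
    unfolding \<zeta> using that by (intro prod_eq_factor_times_cofactor) auto
  have root: "poly R (1 / \<zeta> k) = 0" if k: "k \<in> ?I" for k
    using \<zeta>0[OF k] by (simp add: R_eq[OF k])
  have norm_\<zeta>: "norm (\<zeta> k) = 1" if k: "k \<in> ?I" for k
    using norm_root_eq_1[of "1 / \<zeta> k"] root[OF k] by (simp add: R_def norm_divide)
  have "\<exists>s::real. s > 1 \<and> poly (cofactor \<zeta> ?I k) (1 / \<zeta> k) = poly denom (1 / \<zeta> k) * of_real s"
    if k: "k \<in> ?I" for k
  proof -
    have "- (1 / \<zeta> k) * poly (pderiv R) (1 / \<zeta> k) = poly (cofactor \<zeta> ?I k) (1 / \<zeta> k)"
      using \<zeta>0[OF k] unfolding R_eq[OF k] pderiv_mult by (simp add: pderiv_pCons)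
    with root_pderiv[of "1 / \<zeta> k"] root[OF k] assms show ?thesis by (auto simp: R_def)
  qed
  then obtain s :: "nat \<Rightarrow> real" where s: "\<And>k. k \<in> ?I \<Longrightarrow> s k > 1"
    and L: "\<And>k. k \<in> ?I \<Longrightarrow>
      poly (cofactor \<zeta> ?I k) (1 / \<zeta> k) = poly denom (1 / \<zeta> k) * of_real (s k)"
    by metis
  define t where "t k = 1 / s k" for k
  have denom_root: "poly denom (1 / \<zeta> k) \<noteq> 0" if k: "k \<in> ?I" for k
    using norm_\<zeta>[OF k] by (intro poly_denom_neq_0) (simp add: norm_divide)
  have inj: "inj_on \<zeta> ?I"
  proof (rule inj_onI, rule ccontr)
    fix i k assume ik: "i \<in> ?I" "k \<in> ?I" "\<zeta> i = \<zeta> k" "i \<noteq> k"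
    then have "poly (cofactor \<zeta> ?I k) (1 / \<zeta> k) = 0"
      using poly_cofactor_reciprocal_eq_0[of ?I i k \<zeta>] \<zeta>0 by auto
    with L[OF ik(2)] s[OF ik(2)] denom_root[OF ik(2)] show False by auto
  qed
  have Q: "pf_denom \<zeta> t ?I = denom"
  proof (rule poly_eqI_degree)
    fix x assume "x \<in> (\<lambda>k. 1 / \<zeta> k) ` ?I"
    then obtain k where k: "k \<in> ?I" and x: "x = 1 / \<zeta> k" by auto
    show "poly (pf_denom \<zeta> t ?I) x = poly denom x"
      unfolding x using k \<zeta>0[OF k] L[OF k] s[OF k]
      by (subst poly_pf_denom_reciprocal) (auto simp: t_def)
  next
    have "inj_on (\<lambda>k. 1 / \<zeta> k) ?I"
      using inj \<zeta>0 by (auto simp: inj_on_def)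
    then have card: "card ((\<lambda>k. 1 / \<zeta> k) ` ?I) = m + 1"
      by (simp add: card_image)
    show "degree (pf_denom \<zeta> t ?I) < card ((\<lambda>k. 1 / \<zeta> k) ` ?I)"
      unfolding card using degree_pf_denom_le[of ?I \<zeta> t] by simp
    show "degree denom < card ((\<lambda>k. 1 / \<zeta> k) ` ?I)"
      unfolding card using degree_denom_le by simp
  qed
  have sum_t: "(\<Sum>k\<in>?I. t k) = 1"
    using poly_pf_denom_0[of \<zeta> t ?I] denom_0 unfolding Q by (metis of_real_eq_1_iff)
  have "denom - [:0, 1:] * pf_numer \<zeta> t ?I = denom - [:0, 1:] * numer"
    using pf_denom_minus_numer[of ?I t \<zeta>] sum_t unfolding Q \<zeta>[symmetric] R_def by simp
  then have "[:0, 1:] * pf_numer \<zeta> t ?I = [:0, 1:] * numer"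
    by (simp only: diff_left_imp_eq)
  then have "pf_numer \<zeta> t ?I = numer"
    by (subst (asm) mult_left_cancel) auto
  moreover have "0 < t k \<and> t k < 1" if k: "k \<in> ?I" for k
    using s[OF k] by (simp add: t_def)
  ultimately show thesis using that norm_\<zeta> inj sum_t Q by blast
qed

end

section \<open>From partial fractions to Blaschke products\<close>

text \<open>
  Reflection of \<open>1 - \<zeta> z\<close> in the circle gives \<open>z - cnj \<zeta> = - cnj \<zeta> (1 - \<zeta> z)\<close> for unimodular \<open>\<zeta>\<close>.
  In the cofactor \<open>L\<^sub>k\<close> the factor \<open>- cnj \<zeta>\<^sub>k\<close> is missing from the product of constants, whence the
  \<open>\<zeta>\<^sub>k\<close> that turns \<open>Q\<close> into \<open>N\<close>.
\<close>

lemma pf_denom_reflection: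
  fixes \<zeta> :: "'i \<Rightarrow> complex"
  assumes fin: "finite I" and norm_\<zeta>: "\<And>k. k \<in> I \<Longrightarrow> norm (\<zeta> k) = 1" and "z \<noteq> 0"
  shows "z ^ (card I - 1) * cnj (poly (pf_denom \<zeta> t I) (1 / cnj z))
    = - (\<Prod>k\<in>I. - cnj (\<zeta> k)) * poly (pf_numer \<zeta> t I) z"
proof -
  have \<zeta>1: "\<zeta> k * cnj (\<zeta> k) = 1" if "k \<in> I" for k
    using norm_\<zeta>[OF that] by (simp add: complex_norm_square[symmetric])
  have L: "z ^ (card I - 1) * cnj (poly (cofactor \<zeta> I k) (1 / cnj z))
      = - (\<Prod>j\<in>I. - cnj (\<zeta> j)) * (\<zeta> k * poly (cofactor \<zeta> I k) z)" if k: "k \<in> I" for k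
  proof -
    have "z ^ (card I - 1) * cnj (poly (cofactor \<zeta> I k) (1 / cnj z))
        = (\<Prod>j\<in>I - {k}. z * (1 - cnj (\<zeta> j) / z))"
      using fin k by (simp add: cofactor_def poly_prod prod.distrib)
    also have "\<dots> = (\<Prod>j\<in>I - {k}. - cnj (\<zeta> j) * (1 - \<zeta> j * z))"
      using \<zeta>1 \<open>z \<noteq> 0\<close> by (intro prod.cong) (auto simp: algebra_simps)
    also have "\<dots> = (\<Prod>j\<in>I - {k}. - cnj (\<zeta> j)) * poly (cofactor \<zeta> I k) z"
      by (simp only: prod.distrib) (simp add: cofactor_def poly_prod mult.commute)
    also have "(\<Prod>j\<in>I - {k}. - cnj (\<zeta> j)) = - (\<Prod>j\<in>I. - cnj (\<zeta> j)) * \<zeta> k"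
      using \<zeta>1[OF k] by (simp add: prod.remove[OF fin k] algebra_simps)
    finally show ?thesis by (simp add: mult.assoc)
  qed
  have "z ^ (card I - 1) * cnj (poly (pf_denom \<zeta> t I) (1 / cnj z))
      = (\<Sum>k\<in>I. of_real (t k) * (z ^ (card I - 1) * cnj (poly (cofactor \<zeta> I k) (1 / cnj z))))"
    by (simp add: pf_denom_def poly_sum sum_distrib_left algebra_simps)
  also have "\<dots> = (\<Sum>k\<in>I. of_real (t k) *
      (- (\<Prod>j\<in>I. - cnj (\<zeta> j)) * (\<zeta> k * poly (cofactor \<zeta> I k) z)))"
    using L by (intro sum.cong) auto
  also have "\<dots> = - (\<Prod>k\<in>I. - cnj (\<zeta> k)) * poly (pf_numer \<zeta> t I) z"
    by (simp add: pf_numer_def poly_sum sum_distrib_left algebra_simps)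
  finally show ?thesis .
qed

text \<open>
  A zero \<open>w\<close> of \<open>Q\<close> on the circle is its own mirror image, hence a zero of \<open>N\<close> and of \<open>R = Q - z N\<close>.
  But at the zeros of \<open>R\<close> the value of \<open>Q\<close> is \<open>t\<^sub>k L\<^sub>k\<close>, which is not 0.
\<close>

lemma pf_denom_neq_0_on_circle:
  fixes \<zeta> :: "'i \<Rightarrow> complex"
  assumes fin: "finite I" and norm_\<zeta>: "\<And>k. k \<in> I \<Longrightarrow> norm (\<zeta> k) = 1" and inj: "inj_on \<zeta> I"
    and t: "\<And>k. k \<in> I \<Longrightarrow> t k \<noteq> 0" and sum_t: "(\<Sum>k\<in>I. t k) = 1" and w: "norm w = 1"
  shows "poly (pf_denom \<zeta> t I) w \<noteq> 0"
proof
  assume Q: "poly (pf_denom \<zeta> t I) w = 0"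
  have \<zeta>0: "\<zeta> k \<noteq> 0" if "k \<in> I" for k using norm_\<zeta>[OF that] by auto
  have w0: "w \<noteq> 0" using w by auto
  have "w * cnj w = 1" using w by (simp add: complex_norm_square[symmetric])
  then have "1 / cnj w = w" using w0 by (simp add: field_simps)
  then have "(\<Prod>k\<in>I. - cnj (\<zeta> k)) * poly (pf_numer \<zeta> t I) w = 0"
    using pf_denom_reflection[of I \<zeta> w t] fin norm_\<zeta> w0 Q by simp
  then have "poly (pf_numer \<zeta> t I) w = 0" using \<zeta>0 fin by auto
  with Q obtain k where k: "k \<in> I" and "1 - \<zeta> k * w = 0"
    using pf_common_zero[OF fin sum_t] by blast
  then have "w = 1 / \<zeta> k" using \<zeta>0[OF k] by (simp add: field_simps)
  with Q have "of_real (t k) * poly (cofactor \<zeta> I k) (1 / \<zeta> k) = 0"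
    using poly_pf_denom_reciprocal[of I k \<zeta> t] fin k \<zeta>0[OF k] by simp
  with poly_cofactor_reciprocal_neq_0[OF fin k inj \<zeta>0[OF k]] t[OF k] show False by simp
qed

lemma partial_fractions_Blaschke_fraction:
  fixes \<zeta> :: "'i \<Rightarrow> complex"
  assumes fin: "finite I" and card: "card I = m + 1"
    and norm_\<zeta>: "\<And>k. k \<in> I \<Longrightarrow> norm (\<zeta> k) = 1" and sum_t: "(\<Sum>k\<in>I. t k) = 1"
    and nz: "\<And>z. norm z \<le> 1 \<Longrightarrow> poly (pf_denom \<zeta> t I) z \<noteq> 0"
  obtains c b where "Blaschke_data m c b" and "pf_denom \<zeta> t I = Blaschke_data.denom m b"
    and "pf_numer \<zeta> t I = Blaschke_data.numer m c b"
proof -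
  have "poly (pf_denom \<zeta> t I) 0 = 1" by (simp add: poly_pf_denom_0 sum_t)
  then obtain a where a: "pf_denom \<zeta> t I = (\<Prod>k\<in>{1..m}. [:1, - a k:])"
    using poly_factorization_reciprocal_roots degree_pf_denom_le[OF fin, of \<zeta> t] card by fastforce
  define E where "E = (\<Prod>k\<in>I. - cnj (\<zeta> k))"
  have norm_E: "norm E = 1" by (simp add: E_def prod_norm[symmetric] norm_\<zeta>)
  define c where "c = - (1 / E)"
  define b where "b k = cnj (a k)" for k
  have "norm (b k) < 1" if k: "k \<in> {1..m}" for k
  proof (rule ccontr)
    assume "\<not> norm (b k) < 1"
    then have norm_a: "norm (a k) \<ge> 1" by (simp add: b_def)
    then have "a k \<noteq> 0" by auto
    then have "poly (pf_denom \<zeta> t I) (1 / a k) = 0"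
      unfolding a poly_prod using k by (intro prod_zero) (auto intro!: bexI[of _ k])
    moreover have "norm (1 / a k) \<le> 1" using norm_a \<open>a k \<noteq> 0\<close> by (simp add: norm_divide divide_le_eq_1)
    ultimately show False using nz by blast
  qed
  moreover have "norm c = 1" by (simp add: c_def norm_divide norm_E)
  ultimately interpret B: Blaschke_data m c b by unfold_locales
  have "pf_denom \<zeta> t I = B.denom" by (simp add: a B.denom_def b_def)
  moreover have "pf_numer \<zeta> t I = B.numer"
  proof (rule poly_eqI_nonzero)
    fix z :: complex assume z: "z \<noteq> 0"
    have "- E * poly (pf_numer \<zeta> t I) z = z ^ m * cnj (poly (pf_denom \<zeta> t I) (1 / cnj z))"
      using pf_denom_reflection[OF fin norm_\<zeta> z, where t = t] card by (simp add: E_def)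
    also have "\<dots> = (\<Prod>k\<in>{1..m}. z * (1 - b k / z))"
      by (simp add: a b_def poly_prod prod.distrib)
    also have "\<dots> = (\<Prod>k\<in>{1..m}. z - b k)"
      using z by (intro prod.cong) (auto simp: algebra_simps)
    finally have N: "(\<Prod>k\<in>{1..m}. z - b k) = - E * poly (pf_numer \<zeta> t I) z" ..
    have "E \<noteq> 0" using norm_E by auto
    then show "poly (pf_numer \<zeta> t I) z = poly B.numer z"
      unfolding B.poly_numer N by (simp add: c_def)
  qed
  ultimately show thesis using that B.Blaschke_data_axioms by blast
qed

section \<open>Logarithmic derivatives\<close>

lemma one_minus_unimodular_mult_notin_nonpos_Reals:
  fixes \<zeta> z :: complex
  assumes "norm \<zeta> = 1" and "norm z < 1"
  shows "1 - \<zeta> * z \<notin> \<real>\<^sub>\<le>\<^sub>0"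
proof -
  have "Re (\<zeta> * z) < 1"
    using complex_Re_le_cmod[of "\<zeta> * z"] assms by (simp add: norm_mult)
  then show ?thesis by (auto simp: complex_nonpos_Reals_iff)
qed

text \<open>
  The product on the right is the exponential of a primitive of its logarithmic derivative and takes
  the value 1 at the origin, as does \<open>g\<close>; if the logarithmic derivatives agree, the quotient of the
  two functions is constant.
\<close>

lemma eq_prod_powr_iff_log_deriv:
  fixes g :: "complex \<Rightarrow> complex" and \<zeta> :: "'i \<Rightarrow> complex" and a :: "'i \<Rightarrow> real"
  assumes "g holomorphic_on \<D>" and "g 0 = 1" and g_nz: "\<And>z. z \<in> \<D> \<Longrightarrow> g z \<noteq> 0"
    and fin: "finite I" and norm_\<zeta>: "\<And>k. k \<in> I \<Longrightarrow> norm (\<zeta> k) = 1"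
  shows "(\<forall>z\<in>\<D>. g z = (\<Prod>k\<in>I. 1 / (1 - \<zeta> k * z) powr of_real (a k)))
    \<longleftrightarrow> (\<forall>z\<in>\<D>. deriv g z / g z = (\<Sum>k\<in>I. of_real (a k) * \<zeta> k / (1 - \<zeta> k * z)))"
proof -
  define S where "S z = (\<Sum>k\<in>I. of_real (a k) * \<zeta> k / (1 - \<zeta> k * z))" for z
  define H where "H z = exp (\<Sum>k\<in>I. - (of_real (a k) * Ln (1 - \<zeta> k * z)))" for z
  have not_nonpos: "1 - \<zeta> k * z \<notin> \<real>\<^sub>\<le>\<^sub>0" if "k \<in> I" "z \<in> \<D>" for k z
    using one_minus_unimodular_mult_notin_nonpos_Reals[OF norm_\<zeta>[OF that(1)]] that by simp
  have H_prod: "(\<Prod>k\<in>I. 1 / (1 - \<zeta> k * z) powr of_real (a k)) = H z" if z: "z \<in> \<D>" for z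
    unfolding H_def exp_sum[OF fin]
  proof (rule prod.cong)
    fix k assume "k \<in> I"
    then have "1 - \<zeta> k * z \<noteq> 0" using not_nonpos[OF _ z] by fastforce
    then show "1 / (1 - \<zeta> k * z) powr of_real (a k) = exp (- (of_real (a k) * Ln (1 - \<zeta> k * z)))"
      by (simp add: powr_def exp_minus field_simps)
  qed simp
  have H_deriv: "(H has_field_derivative H z * S z) (at z)" if z: "z \<in> \<D>" for z
    unfolding H_def S_def using not_nonpos[OF _ z]
    by (auto intro!: derivative_eq_intros sum.cong simp: divide_inverse mult_ac)
  have g_deriv: "(g has_field_derivative deriv g z) (at z)" if "z \<in> \<D>" for z
    using assms(1) that by (intro holomorphic_derivI[of _ \<D>]) auto
  have "(\<forall>z\<in>\<D>. g z = H z) \<longleftrightarrow> (\<forall>z\<in>\<D>. deriv g z / g z = S z)"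
  proof
    assume eq: "\<forall>z\<in>\<D>. g z = H z"
    show "\<forall>z\<in>\<D>. deriv g z / g z = S z"
    proof
      fix z assume z: "z \<in> \<D>"
      have "(g has_field_derivative H z * S z) (at z)"
        using eq by (intro has_field_derivative_transform_within_open[OF H_deriv[OF z] open_ball z]) simp
      then show "deriv g z / g z = S z"
        using eq g_nz z by (simp add: DERIV_imp_deriv)
    qed
  next
    assume eq: "\<forall>z\<in>\<D>. deriv g z / g z = S z"
    have "((\<lambda>z. g z / H z) has_field_derivative 0) (at z within \<D>)" if z: "z \<in> \<D>" for z
    proof -
      have "deriv g z / g z = S z" using eq z by blast
      then have "deriv g z = g z * S z"
        using g_nz[OF z] by (metis nonzero_divide_eq_eq mult.commute)
      moreover have "H z \<noteq> 0" by (simp add: H_def)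
      ultimately have "((\<lambda>z. g z / H z) has_field_derivative 0) (at z)"
        using DERIV_divide[OF g_deriv[OF z] H_deriv[OF z]] by simp
      then show ?thesis by (rule has_field_derivative_at_within)
    qed
    then obtain c where c: "\<And>z. z \<in> \<D> \<Longrightarrow> g z / H z = c"
      using has_field_derivative_zero_constant[of \<D> "\<lambda>z. g z / H z"] by auto
    from c[of 0] have "c = 1" using assms(2) by (simp add: H_def)
    with c show "\<forall>z\<in>\<D>. g z = H z" by (auto simp: H_def)
  qed
  then show ?thesis using H_prod by (simp add: S_def)
qed

section \<open>The characterisation\<close>

lemma finite_Blaschke_product_iff_quotient:
  "finite_Blaschke_product m \<phi> \<longleftrightarrow> (\<exists>c b. Blaschke_data m c b \<and>
    (\<forall>z\<in>\<D>. \<phi> z * poly (Blaschke_data.denom m b) z = poly (Blaschke_data.numer m c b) z))"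
proof
  assume "finite_Blaschke_product m \<phi>"
  then obtain \<theta> b where b: "\<forall>k\<in>{1..m}. b k \<in> \<D>"
    and \<phi>: "\<forall>z\<in>\<D>. \<phi> z = exp (\<i> * of_real \<theta>) * (\<Prod>k=1..m. (z - b k) / (1 - cnj (b k) * z))"
    unfolding finite_Blaschke_product_def by auto
  interpret B: Blaschke_data m "exp (\<i> * of_real \<theta>)" b
    using b by unfold_locales auto
  have "\<phi> z * poly B.denom z = poly B.numer z" if z: "z \<in> \<D>" for z
    using B.poly_denom_neq_0[of z] z \<phi>
    by (simp add: prod_dividef B.poly_denom B.poly_numer)
  then show "\<exists>c b. Blaschke_data m c b \<and>
    (\<forall>z\<in>\<D>. \<phi> z * poly (Blaschke_data.denom m b) z = poly (Blaschke_data.numer m c b) z)"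
    using B.Blaschke_data_axioms by blast
next
  assume "\<exists>c b. Blaschke_data m c b \<and>
    (\<forall>z\<in>\<D>. \<phi> z * poly (Blaschke_data.denom m b) z = poly (Blaschke_data.numer m c b) z)"
  then obtain c b where "Blaschke_data m c b" and
    \<phi>: "\<And>z. z \<in> \<D> \<Longrightarrow> \<phi> z * poly (Blaschke_data.denom m b) z = poly (Blaschke_data.numer m c b) z"
    by blast
  then interpret B: Blaschke_data m c b by simp
  have c: "exp (\<i> * of_real (Arg c)) = c"
  proof -
    have "c \<noteq> 0" using B.norm_c by auto
    then have "cis (Arg c) = c" using B.norm_c by (simp add: cis_Arg sgn_eq)
    then show ?thesis by (simp add: cis_conv_exp)
  qed
  have "\<phi> z = c * (\<Prod>k=1..m. (z - b k) / (1 - cnj (b k) * z))" if z: "z \<in> \<D>" for z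
    using B.poly_denom_neq_0[of z] z \<phi>[OF z]
    by (simp add: prod_dividef B.poly_denom B.poly_numer eq_divide_eq)
  then show "finite_Blaschke_product m \<phi>"
    unfolding finite_Blaschke_product_def using B.norm_b c
    by (intro exI[of _ "Arg c"] exI[of _ b]) auto
qed

text \<open>
  The bound \<open>|\<phi>| \<le> 1\<close> makes \<open>\<phi> / (1 - z \<phi>)\<close> finite in the disc, so that the expansion is equivalent
  to \<open>\<phi> Q = N\<close>. The two algebraic lemmas then translate between \<open>N / Q\<close> and Blaschke products.
\<close>

lemma finite_Blaschke_product_iff_partial_fractions:
  assumes \<phi>: "\<phi> \<in> class_B" and "m \<ge> 1"
  shows "finite_Blaschke_product m \<phi> \<longleftrightarrow>
    (\<exists>(\<zeta> :: nat \<Rightarrow> complex) (t :: nat \<Rightarrow> real).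
       (\<forall>k\<in>{1..m+1}. \<zeta> k \<in> \<T>) \<and> inj_on \<zeta> {1..m+1} \<and>
       (\<forall>k\<in>{1..m+1}. 0 < t k \<and> t k < 1) \<and> (\<Sum>k=1..m+1. t k) = 1 \<and>
       (\<forall>z\<in>\<D>. \<phi> z / (1 - z * \<phi> z) = (\<Sum>k=1..m+1. of_real (t k) * \<zeta> k / (1 - \<zeta> k * z))))"
proof -
  let ?I = "{1..m+1}"
  have \<phi>1: "1 - z * \<phi> z \<noteq> 0" if z: "z \<in> \<D>" for z
  proof
    assume "1 - z * \<phi> z = 0"
    then have "z * \<phi> z = 1" by simp
    then have "norm (z * \<phi> z) = 1" by simp
    moreover have "norm z * norm (\<phi> z) \<le> norm z"
      using \<phi> z by (intro mult_left_le) (auto simp: class_B_def)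
    ultimately show False using z by (simp add: norm_mult)
  qed
  have nz: "1 - \<zeta> * z \<noteq> 0" if "norm \<zeta> = 1" "z \<in> \<D>" for \<zeta> z :: complex
    using one_minus_unimodular_mult_notin_nonpos_Reals[OF that(1), of z] that by auto
  have iff: "\<phi> z / (1 - z * \<phi> z) = (\<Sum>k\<in>?I. of_real (t k) * \<zeta> k / (1 - \<zeta> k * z))
      \<longleftrightarrow> \<phi> z * poly (pf_denom \<zeta> t ?I) z = poly (pf_numer \<zeta> t ?I) z"
    if "\<forall>k\<in>?I. \<zeta> k \<in> \<T>" "(\<Sum>k\<in>?I. t k) = 1" "z \<in> \<D>" for \<zeta> t z
  proof (rule partial_fractions_iff_quotient)
    show "1 - \<zeta> k * z \<noteq> 0" if "k \<in> ?I" for k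
      using nz[of "\<zeta> k" z] \<open>\<forall>k\<in>?I. \<zeta> k \<in> \<T>\<close> \<open>z \<in> \<D>\<close> that by simp
  qed (use that \<phi>1 in \<open>simp_all only: finite_atLeastAtMost simp_thms\<close>)
  show ?thesis
  proof
    assume "finite_Blaschke_product m \<phi>"
    then obtain c b where "Blaschke_data m c b" and
      quot: "\<And>z. z \<in> \<D> \<Longrightarrow>
        \<phi> z * poly (Blaschke_data.denom m b) z = poly (Blaschke_data.numer m c b) z"
      unfolding finite_Blaschke_product_iff_quotient by blast
    then interpret B: Blaschke_data m c b by simp
    obtain \<zeta> t where norm_\<zeta>: "\<And>k. k \<in> ?I \<Longrightarrow> norm (\<zeta> k) = 1" and inj: "inj_on \<zeta> ?I"
      and t: "\<And>k. k \<in> ?I \<Longrightarrow> 0 < t k \<and> t k < 1" and sum_t: "(\<Sum>k\<in>?I. t k) = 1"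
      and QN: "pf_denom \<zeta> t ?I = B.denom" "pf_numer \<zeta> t ?I = B.numer"
      by (rule B.Blaschke_fraction_partial_fractions[OF \<open>m \<ge> 1\<close>]) blast
    have \<zeta>: "\<forall>k\<in>?I. \<zeta> k \<in> \<T>" using norm_\<zeta> by simp
    have t': "\<forall>k\<in>?I. 0 < t k \<and> t k < 1" using t by blast
    have "\<forall>z\<in>\<D>. \<phi> z / (1 - z * \<phi> z) = (\<Sum>k\<in>?I. of_real (t k) * \<zeta> k / (1 - \<zeta> k * z))"
    proof
      fix z :: complex assume z: "z \<in> \<D>"
      show "\<phi> z / (1 - z * \<phi> z) = (\<Sum>k\<in>?I. of_real (t k) * \<zeta> k / (1 - \<zeta> k * z))"
        unfolding iff[OF \<zeta> sum_t z] QN by (rule quot[OF z])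
    qed
    with \<zeta> inj t' sum_t show "\<exists>\<zeta> t. (\<forall>k\<in>?I. \<zeta> k \<in> \<T>) \<and> inj_on \<zeta> ?I \<and>
       (\<forall>k\<in>?I. 0 < t k \<and> t k < 1) \<and> (\<Sum>k\<in>?I. t k) = 1 \<and>
       (\<forall>z\<in>\<D>. \<phi> z / (1 - z * \<phi> z) = (\<Sum>k\<in>?I. of_real (t k) * \<zeta> k / (1 - \<zeta> k * z)))"
      by (intro exI[of _ \<zeta>] exI[of _ t] conjI)
  next
    assume "\<exists>\<zeta> t. (\<forall>k\<in>?I. \<zeta> k \<in> \<T>) \<and> inj_on \<zeta> ?I \<and>
       (\<forall>k\<in>?I. 0 < t k \<and> t k < 1) \<and> (\<Sum>k\<in>?I. t k) = 1 \<and>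
       (\<forall>z\<in>\<D>. \<phi> z / (1 - z * \<phi> z) = (\<Sum>k\<in>?I. of_real (t k) * \<zeta> k / (1 - \<zeta> k * z)))"
    then obtain \<zeta> :: "nat \<Rightarrow> complex" and t :: "nat \<Rightarrow> real"
      where \<zeta>: "\<forall>k\<in>?I. \<zeta> k \<in> \<T>" and inj: "inj_on \<zeta> ?I"
      and t: "\<forall>k\<in>?I. 0 < t k \<and> t k < 1" and sum_t: "(\<Sum>k\<in>?I. t k) = 1"
      and pf: "\<And>z. z \<in> \<D> \<Longrightarrow>
        \<phi> z / (1 - z * \<phi> z) = (\<Sum>k\<in>?I. of_real (t k) * \<zeta> k / (1 - \<zeta> k * z))"
      by blast
    have quot: "\<phi> z * poly (pf_denom \<zeta> t ?I) z = poly (pf_numer \<zeta> t ?I) z" if "z \<in> \<D>" for z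
      using iff[OF \<zeta> sum_t that] pf[OF that] by simp
    have norm_\<zeta>: "norm (\<zeta> k) = 1" if "k \<in> ?I" for k using \<zeta> that by auto
    have "poly (pf_denom \<zeta> t ?I) z \<noteq> 0" if z: "norm z \<le> 1" for z
    proof (cases "norm z = 1")
      case True
      then show ?thesis
        using norm_\<zeta> inj t sum_t by (intro pf_denom_neq_0_on_circle) force+
    next
      case False
      \<comment> \<open>By \<open>\<phi> Q = N\<close>, a zero of \<open>Q\<close> in the open disc is shared by \<open>N\<close>, hence by \<open>R\<close>, whose zeros all
        have modulus 1.\<close>
      then have zD: "z \<in> \<D>" using z by simp
      show ?thesis
      proof
        assume Q: "poly (pf_denom \<zeta> t ?I) z = 0"
        with quot[OF zD] have "poly (pf_numer \<zeta> t ?I) z = 0" by simp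
        with Q obtain k where k: "k \<in> ?I" and "1 - \<zeta> k * z = 0"
          using pf_common_zero[OF _ sum_t] by blast
        with nz[OF norm_\<zeta>[OF k] zD] show False by simp
      qed
    qed
    then obtain c b where "Blaschke_data m c b" "pf_denom \<zeta> t ?I = Blaschke_data.denom m b"
      "pf_numer \<zeta> t ?I = Blaschke_data.numer m c b"
      using partial_fractions_Blaschke_fraction[of ?I m \<zeta> t] norm_\<zeta> sum_t by auto
    with quot show "finite_Blaschke_product m \<phi>"
      unfolding finite_Blaschke_product_iff_quotient by metis
  qed
qed

theorem theorem3p2:
  fixes \<alpha> :: real and f \<phi> :: "complex \<Rightarrow> complex" and m :: nat
  assumes "0 < \<alpha>" and "\<alpha> \<le> 3"
    and "f \<in> class_F \<alpha>"
    and "\<phi> \<in> class_B"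
    and "\<And>z. z \<in> \<D> \<Longrightarrow>
           deriv (deriv f) z / deriv f z = of_real \<alpha> * \<phi> z / (1 - z * \<phi> z)"
    and "m \<ge> 1"
  shows "finite_Blaschke_product m \<phi> \<longleftrightarrow>
    (\<exists>(\<zeta> :: nat \<Rightarrow> complex) (t :: nat \<Rightarrow> real).
       (\<forall>k\<in>{1..m+1}. \<zeta> k \<in> \<T>) \<and> inj_on \<zeta> {1..m+1} \<and>
       (\<forall>k\<in>{1..m+1}. 0 < t k \<and> t k < 1) \<and> (\<Sum>k=1..m+1. t k) = 1 \<and>
       (\<forall>z\<in>\<D>. deriv f z = (\<Prod>k=1..m+1. 1 / (1 - \<zeta> k * z) powr (of_real (\<alpha> * t k)))))"
proof -
  have f: "deriv f holomorphic_on \<D>" "deriv f 0 = 1" "\<And>z. z \<in> \<D> \<Longrightarrow> deriv f z \<noteq> 0"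
    using assms(3) by (auto simp: class_F_def class_A_def intro!: holomorphic_deriv)
  \<comment> \<open>The exponents are \<open>\<alpha> t\<^sub>k\<close>, so the common factor \<open>\<alpha>\<close> of the two logarithmic derivatives cancels.\<close>
  have "(\<forall>z\<in>\<D>. deriv f z = (\<Prod>k=1..m+1. 1 / (1 - \<zeta> k * z) powr (of_real (\<alpha> * t k))))
      \<longleftrightarrow> (\<forall>z\<in>\<D>. \<phi> z / (1 - z * \<phi> z) = (\<Sum>k=1..m+1. of_real (t k) * \<zeta> k / (1 - \<zeta> k * z)))"
    if "\<forall>k\<in>{1..m+1}. \<zeta> k \<in> \<T>" for \<zeta> :: "nat \<Rightarrow> complex" and t :: "nat \<Rightarrow> real"
  proof -
    have "deriv (deriv f) z / deriv f z = (\<Sum>k=1..m+1. of_real (\<alpha> * t k) * \<zeta> k / (1 - \<zeta> k * z))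
        \<longleftrightarrow> \<phi> z / (1 - z * \<phi> z) = (\<Sum>k=1..m+1. of_real (t k) * \<zeta> k / (1 - \<zeta> k * z))"
      if "z \<in> \<D>" for z
    proof -
      have "(\<Sum>k=1..m+1. of_real (\<alpha> * t k) * \<zeta> k / (1 - \<zeta> k * z))
          = of_real \<alpha> * (\<Sum>k=1..m+1. of_real (t k) * \<zeta> k / (1 - \<zeta> k * z))"
        unfolding sum_distrib_left by (intro sum.cong) auto
      moreover have "deriv (deriv f) z / deriv f z = of_real \<alpha> * (\<phi> z / (1 - z * \<phi> z))"
        using assms(5)[OF that] by simp
      moreover have "complex_of_real \<alpha> \<noteq> 0" using \<open>0 < \<alpha>\<close> by simp
      ultimately show ?thesis by (simp only: mult_left_cancel simp_thms)
    qed
    moreover have "(\<forall>z\<in>\<D>. deriv f z = (\<Prod>k=1..m+1. 1 / (1 - \<zeta> k * z) powr (of_real (\<alpha> * t k))))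
      \<longleftrightarrow> (\<forall>z\<in>\<D>. deriv (deriv f) z / deriv f z
            = (\<Sum>k=1..m+1. of_real (\<alpha> * t k) * \<zeta> k / (1 - \<zeta> k * z)))"
      using that by (intro eq_prod_powr_iff_log_deriv f) auto
    ultimately show ?thesis by (simp del: sum.cl_ivl_Suc prod.cl_ivl_Suc)
  qed
  then show ?thesis
    unfolding finite_Blaschke_product_iff_partial_fractions[OF assms(4,6)]
    by (intro ex_cong1 conj_cong refl) auto
qed

end
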